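(* Let $G\in\mathbb{Im}^\infty$, let $S_G$ be its set of immediate nimbers and $P_G$ its set of protected nimbers, and let $\mathcal{N}$ denote the set of all nimbers (affine impartial games equal to nimbers). Then: (i) if $S_G\cup P_G=\mathcal{N}$, then $G=_{\mathbb{Im}^\infty}\{\infty\,|\,\overline{\infty}\}$ (the moon) and $\mathrm{mex}(\mathcal{G}(S_G\cup P_G))=\infty$; (ii) if $S_G\cup P_G\neq\mathcal{N}$, then $G=_{\mathbb{Im}^\infty}*\bigl(\mathrm{mex}(\mathcal{G}(S_G\cup P_G))\bigr)$.
   Context: Affine normal play forms are built from terminating games $\infty$ (Left wins) and $\overline{\infty}$ (Right wins), absorbing under disjunctive sum, with $0=\{\overline{\infty}\,|\,\infty\}$. A Left-check is a form with $\infty$ among its Left options; a quiet form is neither $\infty,\overline{\infty}$ nor a check. $G$ is affine impartial ($G\in\mathbb{Im}^\infty$) if $G$ and all its quiet followers are symmetric (Right options are the conjugates of Left options, conjugation swapping players and $\infty\leftrightarrow\overline{\infty}$). Equality modulo $\mathbb{Im}^\infty$ means equal outcomes when added to every $X\in\mathbb{Im}^\infty$. The immediate nimbers $S_G$ are the Left options of $G$ that equal nimbers. The protected nimbers $P_G$ are: all nimbers if $\infty$ is a Left option of $G$; otherwise the set of $*n$ such that some Left option $G^{L}$ of $G$ that is a Left-check satisfies $G^{L}+*n\in\mathscr{L}$. $\mathcal{G}$ maps a set of nimbers $\{*n_i\}$ to $\{n_i\}$, and $\mathrm{mex}$ is the least nonnegative integer not in a set; the Sprague–Grundy value of the moon is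 defined as $\infty$. *)

theory Defs
  imports Main "HOL-Library.FSet" "HOL-Library.Extended_Nat"
begin

text \<open>\<^term>\<open>Pos_Inf\<close> is the terminating game \<open>\<infinity>\<close> (Left has won), \<^term>\<open>Neg_Inf\<close> is \<open>\<infinity>\<close> with a bar
  (Right has won), and \<open>Form A B\<close> is \<open>{A | B}\<close>. Games are short: option sets are finite.\<close>

datatype game = Pos_Inf | Neg_Inf | Form "game fset" "game fset"

fun left_opts :: "game \<Rightarrow> game set" where
  "left_opts (Form A B) = fset A"
| "left_opts _ = {}"

fun right_opts :: "game \<Rightarrow> game set" where
  "right_opts (Form A B) = fset B"
| "right_opts _ = {}"

text \<open>The affine normal play forms. A player without a good move has to move to a losing infinity,
  as in \<open>0 = {Neg_Inf | Pos_Inf}\<close>; only the two infinities lack options.\<close>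

inductive_set Np :: "game set" where
  "Pos_Inf \<in> Np"
| "Neg_Inf \<in> Np"
| "\<lbrakk>A \<noteq> {||}; B \<noteq> {||}; \<And>H. H |\<in>| A \<Longrightarrow> H \<in> Np; \<And>H. H |\<in>| B \<Longrightarrow> H \<in> Np\<rbrakk> \<Longrightarrow> Form A B \<in> Np"

lemma size_option [termination_simp]:
  fixes H :: game
  assumes "H |\<in>| A"
  shows "size H < Suc ((\<Sum>x \<in> fset A. Suc (size x)) + n)"
    and "size H < Suc (n + (\<Sum>x \<in> fset A. Suc (size x)))"
proof -
  have "Suc (size H) \<le> (\<Sum>x \<in> fset A. Suc (size x))"
    using assms by (intro member_le_sum) auto
  then show "size H < Suc ((\<Sum>x \<in> fset A. Suc (size x)) + n)"
    and "size H < Suc (n + (\<Sum>x \<in> fset A. Suc (size x)))"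
    by simp_all
qed

text \<open>The sum of the two opposite infinities is not defined in the theory, whence \<^term>\<open>undefined\<close>.
  It never arises inside a sum of two games other than infinities.\<close>

fun game_sum :: "game \<Rightarrow> game \<Rightarrow> game" where
  "game_sum (Form A B) (Form C D) =
     Form ((\<lambda>H. game_sum H (Form C D)) |`| A |\<union>| (\<lambda>H. game_sum (Form A B) H) |`| C)
          ((\<lambda>H. game_sum H (Form C D)) |`| B |\<union>| (\<lambda>H. game_sum (Form A B) H) |`| D)"
| "game_sum Pos_Inf Neg_Inf = undefined"
| "game_sum Neg_Inf Pos_Inf = undefined"
| "game_sum Pos_Inf _ = Pos_Inf"
| "game_sum _ Pos_Inf = Pos_Inf"
| "game_sum Neg_Inf _ = Neg_Inf"
| "game_sum _ Neg_Inf = Neg_Inf"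

datatype player = Left | Right

text \<open>\<open>winner p G\<close> is the winner under optimal play when \<open>p\<close> moves first.\<close>

fun winner :: "player \<Rightarrow> game \<Rightarrow> player" where
  "winner _ Pos_Inf = Left"
| "winner _ Neg_Inf = Right"
| "winner Left (Form A B) = (if \<exists>H \<in> fset A. winner Right H = Left then Left else Right)"
| "winner Right (Form A B) = (if \<exists>H \<in> fset B. winner Left H = Right then Right else Left)"

datatype outcome = \<L> | \<R> | \<N> | \<P>

definition outcome :: "game \<Rightarrow> outcome" where
  "outcome G =
     (case (winner Left G, winner Right G) of
        (Left, Left) \<Rightarrow> \<L>
      | (Right, Right) \<Rightarrow> \<R>
      | (Left, Right) \<Rightarrow> \<N>
      | (Right, Left) \<Rightarrow> \<P>)"

primrec conj_game :: "game \<Rightarrow> game" where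
  "conj_game Pos_Inf = Neg_Inf"
| "conj_game Neg_Inf = Pos_Inf"
| "conj_game (Form A B) = Form (conj_game |`| B) (conj_game |`| A)"

definition left_check :: "game \<Rightarrow> bool" where
  "left_check G \<longleftrightarrow> Pos_Inf \<in> left_opts G"

definition right_check :: "game \<Rightarrow> bool" where
  "right_check G \<longleftrightarrow> Neg_Inf \<in> right_opts G"

definition quiet :: "game \<Rightarrow> bool" where
  "quiet G \<longleftrightarrow> G \<noteq> Pos_Inf \<and> G \<noteq> Neg_Inf \<and> \<not> left_check G \<and> \<not> right_check G"

text \<open>The infinities are not symmetric: their option sets would agree only vacuously.\<close>

definition symmetric :: "game \<Rightarrow> bool" where
  "symmetric G \<longleftrightarrow>
     G \<noteq> Pos_Inf \<and> G \<noteq> Neg_Inf \<and> right_opts G = conj_game ` left_opts G"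

text \<open>Followers are reached by any sequence of moves, not necessarily alternating.\<close>

definition is_option :: "game \<Rightarrow> game \<Rightarrow> bool" where
  "is_option G H \<longleftrightarrow> H \<in> left_opts G \<union> right_opts G"

definition follower :: "game \<Rightarrow> game \<Rightarrow> bool" where
  "follower G H \<longleftrightarrow> is_option\<^sup>*\<^sup>* G H"

definition Im_inf :: "game set" where
  "Im_inf = {G \<in> Np. symmetric G \<and> (\<forall>H. follower G H \<and> quiet H \<longrightarrow> symmetric H)}"

definition eq_Im :: "game \<Rightarrow> game \<Rightarrow> bool" (infix "=\<^sub>I" 50) where
  "G =\<^sub>I H \<longleftrightarrow> (\<forall>X \<in> Im_inf. outcome (game_sum G X) = outcome (game_sum H X))"

definition zero_game :: game where
  "zero_game = Form {|Neg_Inf|} {|Pos_Inf|}"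

fun nimber :: "nat \<Rightarrow> game" where
  "nimber n =
     (if n = 0 then zero_game
      else Form (fset_of_list (map nimber [0..<n])) (fset_of_list (map nimber [0..<n])))"

declare nimber.simps [simp del]

definition moon :: game where
  "moon = Form {|Pos_Inf|} {|Neg_Inf|}"

definition nimbers :: "game set" where
  "nimbers = {G \<in> Im_inf. \<exists>n. G =\<^sub>I nimber n}"

definition immediate_nimbers :: "game \<Rightarrow> game set" where
  "immediate_nimbers G = {GL \<in> left_opts G. \<exists>n. GL =\<^sub>I nimber n}"

definition protected_nimbers :: "game \<Rightarrow> game set" where
  "protected_nimbers G =
     (if Pos_Inf \<in> left_opts G then nimbers
      else {nimber n |n. \<exists>GL \<in> left_opts G.
              left_check GL \<and> outcome (game_sum GL (nimber n)) = \<L>})"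

text \<open>Sets of nimbers are compared up to equality modulo \<^term>\<open>Im_inf\<close>: a set of forms stands for
  the affine impartial games equal to one of its members. In particular \<^term>\<open>nimbers\<close> is
  already closed.\<close>

definition up_to_eq :: "game set \<Rightarrow> game set" where
  "up_to_eq A = {G \<in> Im_inf. \<exists>H \<in> A. G =\<^sub>I H}"

definition nim_values :: "game set \<Rightarrow> nat set" where
  "nim_values A = {n. \<exists>G \<in> A. G =\<^sub>I nimber n}"

text \<open>The least element of \<open>\<nat> \<union> {\<infinity>}\<close> outside \<open>A\<close>, hence \<open>\<infinity>\<close> iff \<open>A\<close> contains every natural number.\<close>

definition mex :: "nat set \<Rightarrow> enat" where
  "mex A = (LEAST x. x \<notin> enat ` A)"

end

theory Submission
  imports Defs
begin

text \<open>A sum of two games that a player loses moving first is again lost by that player moving first,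
  so adding a \<open>\<P>\<close>-position never changes the outcome, and \<open>G = *n\<close> iff \<open>G + *n \<in> \<P>\<close>. If \<open>m\<close> is the least
  number outside \<open>\<G>(S\<^sub>G \<union> P\<^sub>G)\<close>, moving in \<open>G\<close> does not win \<open>G + *m\<close>, and a move to \<open>G + *k\<close> with \<open>k < m\<close>
  is answered in \<open>G\<close>; hence \<open>G = *m\<close>. If there is no such \<open>m\<close>, it remains to see that the first player
  wins \<open>G + X\<close> when \<open>X\<close> is quiet and not a nimber either. Choose \<open>N\<close> such that no quiet follower of \<open>G\<close>
  equals \<open>*N\<close>. Some move in \<open>G\<close> wins \<open>G + *N\<close>, and it is a check. As long as checks are given, nobody can
  afford to move outside the checking component, and once that component is quiet the player to move
  wins, whether it is added to \<open>*N\<close> or (by induction) to \<open>X\<close>. So the same move wins \<open>G + X\<close>.\<close>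

section \<open>Opponents, infinities, options and checks, uniformly in the player\<close>

fun opp :: "player \<Rightarrow> player" where
  "opp Left = Right"
| "opp Right = Left"

fun won :: "player \<Rightarrow> game" where
  "won Left = Pos_Inf"
| "won Right = Neg_Inf"

fun opts :: "player \<Rightarrow> game \<Rightarrow> game set" where
  "opts Left G = left_opts G"
| "opts Right G = right_opts G"

definition is_form :: "game \<Rightarrow> bool" where
  "is_form G \<longleftrightarrow> G \<noteq> Pos_Inf \<and> G \<noteq> Neg_Inf"

definition checks :: "player \<Rightarrow> game \<Rightarrow> bool" where
  "checks p G \<longleftrightarrow> won p \<in> opts p G"

definition is_P :: "game \<Rightarrow> bool" where
  "is_P G \<longleftrightarrow> (\<forall>p. winner p G \<noteq> p)"

lemma opp_opp [simp]: "opp (opp p) = p"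
  by (cases p) auto

lemma opp_neq [simp]: "opp p \<noteq> p" "p \<noteq> opp p"
  by (cases p; simp)+

lemma opp_eq_iff [simp]: "opp p = Left \<longleftrightarrow> p = Right" "opp p = Right \<longleftrightarrow> p = Left"
  by (cases p; simp)+

lemma neq_opp_iff: "q \<noteq> p \<longleftrightarrow> q = opp p"
  by (cases p; cases q) auto

lemma all_players: "(\<forall>p. Q p) \<longleftrightarrow> Q Left \<and> Q Right"
  by (metis player.exhaust)

lemma won_neq [simp]: "won (opp p) \<noteq> won p" "won p \<noteq> won (opp p)"
  by (cases p; simp)+

lemma is_form_iff_won: "is_form G \<longleftrightarrow> G \<noteq> won p \<and> G \<noteq> won (opp p)"
  by (cases p) (auto simp: is_form_def)

lemma is_form_Form [simp]: "is_form (Form A B)"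
  by (simp add: is_form_def)

lemma is_formE:
  assumes "is_form G"
  obtains A B where "G = Form A B"
  using assms by (cases G) (auto simp: is_form_def)

lemma not_is_form_won [simp]: "\<not> is_form (won p)"
  by (cases p) (auto simp: is_form_def)

lemma opts_won [simp]: "opts q (won p) = {}"
  by (cases p; cases q) auto

lemma is_form_if_opts: "H \<in> opts p G \<Longrightarrow> is_form G"
  by (cases p; cases G) auto

lemma size_opts: "H \<in> opts p G \<Longrightarrow> size H < size G"
  by (cases p; cases G) (auto simp: size_option)

lemma finite_opts: "finite (opts p G)"
  by (cases p; cases G) auto

lemma is_option_iff: "is_option G H \<longleftrightarrow> (\<exists>p. H \<in> opts p G)"
  unfolding is_option_def by (metis Un_iff opts.simps player.exhaust)

lemma quiet_iff: "quiet G \<longleftrightarrow> is_form G \<and> (\<forall>p. \<not> checks p G)"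
  by (auto simp: quiet_def is_form_def checks_def all_players left_check_def right_check_def)

lemma game_eqI:
  assumes "is_form G" "is_form H" "\<And>p. opts p G = opts p H"
  shows "G = H"
  using assms(1,2) assms(3)[of Left] assms(3)[of Right]
  by (auto elim!: is_formE simp: fset_inject)

section \<open>Commutativity and associativity of the disjunctive sum\<close>

lemma game_sum_won [simp]:
  "is_form G \<Longrightarrow> game_sum G (won p) = won p"
  "is_form G \<Longrightarrow> game_sum (won p) G = won p"
  by (cases p; auto elim!: is_formE)+

lemma game_sum_won_won [simp]: "game_sum (won p) (won p) = won p"
  by (cases p) auto

lemma is_form_sum: "is_form G \<Longrightarrow> is_form H \<Longrightarrow> is_form (game_sum G H)"
  by (auto elim!: is_formE)

lemma opts_sum:
  assumes "is_form G" "is_form H"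
  shows "opts p (game_sum G H) =
    (\<lambda>K. game_sum K H) ` opts p G \<union> (\<lambda>K. game_sum G K) ` opts p H"
  using assms by (cases p) (auto elim!: is_formE)

lemma game_sum_commute: "game_sum G H = game_sum H G"
proof (induction "size G + size H" arbitrary: G H rule: less_induct)
  case less
  show ?case
  proof (cases "is_form G \<and> is_form H")
    case True
    have "game_sum K H = game_sum H K" if "K \<in> opts p G" for p K
      using less[of K H] size_opts[OF that] by simp
    moreover have "game_sum G K = game_sum K G" if "K \<in> opts p H" for p K
      using less[of G K] size_opts[OF that] by simp
    ultimately show ?thesis
      using True by (intro game_eqI) (auto simp: is_form_sum opts_sum image_iff)
  next
    case False
    then show ?thesis
      by (cases G; cases H) auto
  qed
qed

text \<open>With at least two forms among the summands, no bracketing lets opposite infinities meet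
  in the \<open>undefined\<close> sum, and a single infinity absorbs the rest.\<close>

lemma game_sum_assoc:
  assumes "is_form A \<and> is_form B \<or> is_form A \<and> is_form C \<or> is_form B \<and> is_form C"
  shows "game_sum (game_sum A B) C = game_sum A (game_sum B C)"
  using assms
proof (induction "size A + size B + size C" arbitrary: A B C rule: less_induct)
  case less
  show ?case
  proof (cases "is_form A \<and> is_form B \<and> is_form C")
    case True
    have 1: "game_sum (game_sum H B) C = game_sum H (game_sum B C)" if "H \<in> opts p A" for p H
      using less.hyps[of H B C] True size_opts[OF that] by simp
    have 2: "game_sum (game_sum A H) C = game_sum A (game_sum H C)" if "H \<in> opts p B" for p H
      using less.hyps[of A H C] True size_opts[OF that] by simp
    have 3: "game_sum (game_sum A B) H = game_sum A (game_sum B H)" if "H \<in> opts p C" for p H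
      using less.hyps[of A B H] True size_opts[OF that] by simp
    show ?thesis
      using True by (intro game_eqI)
        (auto simp: is_form_sum opts_sum image_Un image_image Un_assoc 1 2 3
          intro!: arg_cong2[where f = "(\<union>)"] image_cong)
  next
    case False
    then obtain p where "A = won p \<or> B = won p \<or> C = won p"
      by (metis is_form_iff_won)
    with less.prems show ?thesis
      by (auto simp: is_form_sum)
  qed
qed

section \<open>Conjugation and symmetry\<close>

lemma conj_conj [simp]: "conj_game (conj_game G) = G"
proof (induction G)
  case (Form A B)
  then have "(conj_game \<circ> conj_game) |`| A = id |`| A" "(conj_game \<circ> conj_game) |`| B = id |`| B"
    by (auto intro!: fset.map_cong)
  then show ?case
    by (simp add: fset.map_comp fset.map_id)
qed auto

lemma conj_won [simp]: "conj_game (won p) = won (opp p)"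
  by (cases p) auto

lemma is_form_conj [simp]: "is_form (conj_game G) \<longleftrightarrow> is_form G"
  by (cases G) (auto simp: is_form_def)

lemma opts_conj: "opts p (conj_game G) = conj_game ` opts (opp p) G"
  by (cases p; cases G) auto

text \<open>Conjugation is an involution, so the condition on the right options implies the one on
  the left options. In fixed-point form, symmetry passes to sums because conjugation distributes
  over them.\<close>

lemma symmetric_iff: "symmetric G \<longleftrightarrow> is_form G \<and> conj_game G = G"
proof -
  have "conj_game G = G" if "is_form G" "right_opts G = conj_game ` left_opts G"
  proof (rule game_eqI)
    show "opts p (conj_game G) = opts p G" for p
      using that(2) by (cases p) (auto simp: opts_conj image_image)
  qed (use that in auto)
  moreover have "right_opts G = conj_game ` left_opts G" if "conj_game G = G"
    using opts_conj[of Right G] that by simp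
  ultimately show ?thesis
    by (auto simp: symmetric_def is_form_def)
qed

lemma conj_sum:
  assumes "is_form G \<or> is_form H"
  shows "conj_game (game_sum G H) = game_sum (conj_game G) (conj_game H)"
  using assms
proof (induction "size G + size H" arbitrary: G H rule: less_induct)
  case less
  show ?case
  proof (cases "is_form G \<and> is_form H")
    case True
    have "conj_game (game_sum K H) = game_sum (conj_game K) (conj_game H)" if "K \<in> opts p G" for p K
      using less.hyps[of K H] True size_opts[OF that] by simp
    moreover have "conj_game (game_sum G K) = game_sum (conj_game G) (conj_game K)"
      if "K \<in> opts p H" for p K
      using less.hyps[of G K] True size_opts[OF that] by simp
    ultimately show ?thesis
      using True by (intro game_eqI)
        (auto simp: is_form_sum opts_sum opts_conj image_Un image_image
          intro!: arg_cong2[where f = "(\<union>)"] image_cong)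
  next
    case False
    then obtain p where "G = won p \<or> H = won p"
      by (metis is_form_iff_won)
    with less.prems show ?thesis
      by auto
  qed
qed

lemma symmetric_sum: "symmetric G \<Longrightarrow> symmetric H \<Longrightarrow> symmetric (game_sum G H)"
  by (simp add: symmetric_iff is_form_sum conj_sum)

section \<open>Winners of symmetric games, of checks and of sums\<close>

lemma winner_iff:
  "winner p G = p \<longleftrightarrow> G = won p \<or> (\<exists>H \<in> opts p G. winner (opp p) H = p)"
  by (cases p; cases G) auto

lemma winner_won [simp]: "winner q (won p) = p"
  by (cases p) auto

lemma winner_conj: "winner p (conj_game G) = opp (winner (opp p) G)"
proof (induction G arbitrary: p)
  case (Form A B)
  then show ?case
    by (cases p) fastforce+
qed simp_all

text \<open>Conjugation carries a winning strategy of one player moving first over to the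
  other.\<close>

lemma symmetric_winner:
  assumes "symmetric G" "winner p G = p"
  shows "winner q G = q"
  using assms winner_conj[of "opp p" G] by (cases "q = p") (auto simp: symmetric_iff neq_opp_iff)

lemma symmetric_is_P: "symmetric G \<Longrightarrow> winner p G \<noteq> p \<Longrightarrow> is_P G"
  unfolding is_P_def using symmetric_winner by blast

lemma winner_checks: "checks p G \<Longrightarrow> winner p G = p"
  unfolding checks_def by (subst winner_iff) force

lemma checks_sum: "checks p G \<Longrightarrow> is_form H \<Longrightarrow> checks p (game_sum G H)"
  using is_form_if_opts[of "won p" p G] unfolding checks_def
  by (auto simp: opts_sum image_iff intro!: disjI1 bexI[of _ "won p"])

lemma symmetric_checks: "symmetric G \<Longrightarrow> checks p G \<Longrightarrow> checks q G"
  using opts_conj[of q G] unfolding checks_def symmetric_iff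
  by (cases "q = p") (auto simp: neq_opp_iff image_iff intro!: bexI[of _ "won p"])

lemma is_P_is_form: "is_P Z \<Longrightarrow> is_form Z"
  unfolding is_P_def by (metis is_form_iff_won winner_won)

text \<open>The other player answers every move in the component where it was made.\<close>

lemma winner_sum_lose:
  assumes "winner p A \<noteq> p" "winner p B \<noteq> p"
  shows "winner p (game_sum A B) \<noteq> p"
  using assms
proof (induction "size A + size B" arbitrary: A B rule: less_induct)
  case less
  \<comment> \<open>\<open>C\<close> is the component in which \<open>p\<close> has moved; keeping
    \<open>C\<close> and \<open>D\<close> arbitrary covers moves in \<open>A\<close> and in
    \<open>B\<close>.\<close>
  have answer: "winner (opp p) (game_sum K D) \<noteq> p"
    if C: "winner p C \<noteq> p" and D: "winner p D \<noteq> p" and "is_form D" and K: "K \<in> opts p C"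
      and size: "size C + size D \<le> size A + size B" for C D K
  proof -
    have "winner (opp p) K = opp p"
      using C K by (metis winner_iff neq_opp_iff)
    then consider "K = won (opp p)" | L where "L \<in> opts (opp p) K" "winner p L = opp p"
      using winner_iff[of "opp p" K] by auto
    then show ?thesis
    proof cases
      case 1
      then show ?thesis
        using that by simp
    next
      case 2
      then have "winner p (game_sum L D) \<noteq> p"
        using less.hyps[of L D] size size_opts[OF K] size_opts[OF 2(1)] D by simp
      moreover have "game_sum L D \<in> opts (opp p) (game_sum K D)"
        using 2(1) \<open>is_form D\<close> is_form_if_opts[OF 2(1)] by (simp add: opts_sum)
      ultimately have "winner (opp p) (game_sum K D) = opp p"
        using winner_iff[of "opp p"] by (metis neq_opp_iff opp_opp)
      then show ?thesis
        by simp
    qed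
  qed
  show ?case
  proof (cases "is_form A \<and> is_form B")
    case True
    show ?thesis
    proof
      assume "winner p (game_sum A B) = p"
      then obtain H where "H \<in> opts p (game_sum A B)" "winner (opp p) H = p"
        using winner_iff is_form_sum is_form_iff_won True by metis
      then show False
        using True answer[of A B] answer[of B A] less.prems
        by (auto simp: opts_sum) (metis game_sum_commute)
    qed
  next
    case False
    \<comment> \<open>Neither component is \<open>won p\<close>, so any infinity here is
      \<open>won (opp p)\<close>, and so is the sum.\<close>
    then have "A = won (opp p) \<or> B = won (opp p)"
      using less.prems by (metis is_form_iff_won winner_won)
    moreover have "A \<noteq> won p" "B \<noteq> won p"
      using less.prems by auto
    ultimately show ?thesis
      by (metis game_sum_won(1,2) game_sum_won_won is_form_iff_won opp_neq(2) winner_won)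
  qed
qed

text \<open>A winning move in \<open>A\<close> stays winning: afterwards the opponent would lose
  moving first in either component, so \<open>winner_sum_lose\<close> applies. It also covers the
  case where \<open>p\<close> loses \<open>A\<close>.\<close>

lemma winner_sum_is_P:
  assumes "is_P Z"
  shows "winner p (game_sum A Z) = winner p A"
proof -
  have "winner p (game_sum A Z) = p" if win: "winner p A = p"
  proof -
    consider "A = won p" | H where "H \<in> opts p A" "winner (opp p) H = p"
      using win winner_iff[of p A] by auto
    then show ?thesis
    proof cases
      case 1
      then show ?thesis
        using is_P_is_form[OF assms] by simp
    next
      case 2
      then have "winner (opp p) (game_sum H Z) = p"
        using winner_sum_lose[of "opp p" H Z] assms unfolding is_P_def by (metis neq_opp_iff opp_opp)
      moreover have "game_sum H Z \<in> opts p (game_sum A Z)"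
        using 2(1) is_P_is_form[OF assms] is_form_if_opts[OF 2(1)] by (simp add: opts_sum)
      ultimately show ?thesis
        using winner_iff by blast
    qed
  qed
  moreover have "winner p (game_sum A Z) \<noteq> p" if "winner p A \<noteq> p"
    using that assms winner_sum_lose unfolding is_P_def by blast
  ultimately show ?thesis
    by (metis neq_opp_iff)
qed

section \<open>Nimbers\<close>

lemma opts_nimber: "opts p (nimber n) = (if n = 0 then {won (opp p)} else nimber ` {..<n})"
  by (cases p; subst nimber.simps) (auto simp: zero_game_def fset_of_list.rep_eq)

lemma is_form_nimber [simp]: "is_form (nimber n)"
  by (subst nimber.simps) (simp add: zero_game_def)

lemma conj_nimber: "conj_game (nimber n) = nimber n"
proof (induction n rule: less_induct)
  case (less n)
  then show ?case
    by (intro game_eqI) (auto simp: opts_conj opts_nimber image_image cong: image_cong_simp)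
qed

lemma symmetric_nimber: "symmetric (nimber n)"
  by (simp add: symmetric_iff conj_nimber)

lemma quiet_nimber: "quiet (nimber n)"
  by (auto simp: quiet_iff checks_def opts_nimber) (metis is_form_nimber not_is_form_won)

lemma nimber_in_opts: "k < n \<Longrightarrow> nimber k \<in> opts p (nimber n)"
  by (auto simp: opts_nimber)

lemma nimber_sum_move:
  assumes "is_form G" "k < n" "winner (opp p) (game_sum G (nimber k)) = p"
  shows "winner p (game_sum G (nimber n)) = p"
  using assms nimber_in_opts[of k n p] by (subst winner_iff) (auto simp: opts_sum)

text \<open>Reducing one copy to \<open>nimber k\<close> is answered by reducing the other copy
  likewise.\<close>

lemma is_P_nimber_double: "is_P (game_sum (nimber n) (nimber n))"
proof (induction n rule: less_induct)
  case (less n)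
  have False if win: "winner p (game_sum (nimber n) (nimber n)) = p" for p
  proof -
    obtain H where "H \<in> opts p (game_sum (nimber n) (nimber n))" "winner (opp p) H = p"
      using win winner_iff is_form_sum is_form_nimber not_is_form_won by metis
    then obtain K where K: "K \<in> opts p (nimber n)" "winner (opp p) (game_sum (nimber n) K) = p"
      by (auto simp: opts_sum game_sum_commute)
    \<comment> \<open>For \<open>n = 0\<close> the only move is to the losing infinity, which
      absorbs the other component.\<close>
    have "n \<noteq> 0"
      using K by (cases "n = 0") (auto simp: opts_nimber)
    then obtain k where "k < n" "winner (opp p) (game_sum (nimber n) (nimber k)) = p"
      using K by (auto simp: opts_nimber)
    moreover have "winner p (game_sum (nimber k) (nimber k)) = opp p"
      using less[OF \<open>k < n\<close>] by (simp add: is_P_def neq_opp_iff)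
    ultimately show False
      using nimber_sum_move[of "nimber k" k n "opp p"] by (simp add: game_sum_commute)
  qed
  then show ?case
    by (auto simp: is_P_def)
qed

text \<open>From unequal nimbers the first player wins by reducing the larger to the
  smaller.\<close>

lemma is_P_nimber_sumD:
  assumes "is_P (game_sum (nimber m) (nimber n))"
  shows "m = n"
proof -
  have "\<not> is_P (game_sum (nimber m) (nimber n))" if "m < n" for m n
    using that nimber_sum_move[of "nimber m" m n Left] is_P_nimber_double[of m]
    by (auto simp: is_P_def) (metis neq_opp_iff opp.simps(2) player.distinct(1))
  with assms show ?thesis
    by (metis game_sum_commute linorder_neqE_nat)
qed

text \<open>Adding the \<P>-position \<open>*n + *n\<close> to \<open>G + X\<close> and regrouping
  gives \<open>*n + X\<close> plus the \<P>-position \<open>G + *n\<close>; neither addition changes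
  the winner.\<close>

lemma winner_is_P_nimber:
  assumes "is_P (game_sum G (nimber n))" "is_form G" "is_form X"
  shows "winner p (game_sum G X) = winner p (game_sum (nimber n) X)"
proof -
  let ?n = "nimber n"
  have "game_sum (game_sum G X) (game_sum ?n ?n) = game_sum (game_sum ?n X) (game_sum G ?n)"
    using assms(2,3)
    by (smt (verit) game_sum_assoc game_sum_commute is_form_nimber is_form_sum)
  then show ?thesis
    using winner_sum_is_P[OF assms(1)] winner_sum_is_P[OF is_P_nimber_double] by metis
qed

section \<open>Outcomes, followers and affine impartial games\<close>

lemma outcome_eq_iff: "outcome G = outcome H \<longleftrightarrow> (\<forall>p. winner p G = winner p H)"
  by (cases "winner Left G"; cases "winner Right G"; cases "winner Left H"; cases "winner Right H")
    (simp_all add: outcome_def all_players)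

lemma outcome_L_iff: "outcome G = \<L> \<longleftrightarrow> (\<forall>p. winner p G = Left)"
  by (cases "winner Left G"; cases "winner Right G") (simp_all add: outcome_def all_players)

lemma follower_refl: "follower G G"
  by (simp add: follower_def)

lemma follower_opts: "H \<in> opts p G \<Longrightarrow> follower H K \<Longrightarrow> follower G K"
  unfolding follower_def by (meson converse_rtranclp_into_rtranclp is_option_iff)

lemma follower_trans: "follower G H \<Longrightarrow> follower H K \<Longrightarrow> follower G K"
  unfolding follower_def by (rule rtranclp_trans)

lemma follower_cases:
  assumes "follower G K"
  obtains "K = G" | p H where "H \<in> opts p G" "follower H K"
  using assms unfolding follower_def by (metis converse_rtranclpE is_option_iff)

lemma size_follower: "follower G H \<Longrightarrow> size H \<le> size G"
  unfolding follower_def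
  by (induction rule: rtranclp_induct) (use size_opts is_option_iff in fastforce)+

text \<open>Ensures that only finitely many nimbers are equal to a follower of a given game.\<close>

lemma finite_followers: "finite {H. follower G H}"
proof (induction "size G" arbitrary: G rule: less_induct)
  case less
  have "{H. follower G H} \<subseteq> insert G (\<Union>p. \<Union>H \<in> opts p G. {K. follower H K})"
    by (auto elim: follower_cases)
  moreover have "finite (\<Union>p. \<Union>H \<in> opts p G. {K. follower H K})"
  proof (rule finite_UN_I)
    have "UNIV = {Left, Right}"
      using player.exhaust by auto
    then show "finite (UNIV :: player set)"
      by (metis finite.emptyI finite_insert)
  qed (use less size_opts finite_opts in blast)
  ultimately show ?case
    by (meson finite_insert finite_subset)
qed

text \<open>The symmetry condition of \<open>Im_inf\<close> on its own, in the form handed down to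
  quiet followers.\<close>

definition affine_impartial :: "game \<Rightarrow> bool" where
  "affine_impartial G \<longleftrightarrow> symmetric G \<and> (\<forall>H. follower G H \<and> quiet H \<longrightarrow> symmetric H)"

lemma Im_inf_iff: "G \<in> Im_inf \<longleftrightarrow> G \<in> Np \<and> affine_impartial G"
  by (auto simp: Im_inf_def affine_impartial_def)

lemma affine_impartial_follower:
  "affine_impartial G \<Longrightarrow> follower G H \<Longrightarrow> quiet H \<Longrightarrow> affine_impartial H"
  unfolding affine_impartial_def using follower_trans by blast

lemma nimber_Im_inf: "nimber n \<in> Im_inf"
proof -
  have "nimber n \<in> Np"
  proof (induction n rule: less_induct)
    case (less n)
    show ?case
      by (subst nimber.simps)
        (use less in \<open>auto simp: zero_game_def fset_of_list_elem intro!: Np.intros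
          dest: arg_cong[where f = fset] simp: fset_of_list.rep_eq\<close>)
  qed
  \<comment> \<open>An infinity is not quiet, so every quiet follower is itself a nimber.\<close>
  moreover have "(\<exists>m. H = nimber m) \<or> (\<exists>p. H = won p)" if "follower (nimber n) H" for H
    using that unfolding follower_def
    by (induction rule: rtranclp_induct) (auto simp: is_option_iff opts_nimber split: if_splits)
  then have "affine_impartial (nimber n)"
    unfolding affine_impartial_def
    by (metis symmetric_nimber quiet_iff not_is_form_won)
  ultimately show ?thesis
    by (simp add: Im_inf_iff)
qed

section \<open>Equality modulo \<open>Im_inf\<close>, and mex\<close>

lemma eq_nimber_iff:
  assumes "is_form G"
  shows "G =\<^sub>I nimber n \<longleftrightarrow> is_P (game_sum G (nimber n))"
proof
  assume "G =\<^sub>I nimber n"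
  \<comment> \<open>Testing on \<open>X = nimber n\<close> suffices, since \<open>*n + *n\<close> is
    a \<P>-position.\<close>
  then have "winner p (game_sum G (nimber n)) = winner p (game_sum (nimber n) (nimber n))" for p
    using nimber_Im_inf[of n] by (auto simp: eq_Im_def outcome_eq_iff)
  then show "is_P (game_sum G (nimber n))"
    using is_P_nimber_double[of n] by (simp add: is_P_def)
next
  assume "is_P (game_sum G (nimber n))"
  then show "G =\<^sub>I nimber n"
    using assms winner_is_P_nimber
    by (auto simp: eq_Im_def outcome_eq_iff Im_inf_iff affine_impartial_def symmetric_iff)
qed

lemma won_not_eq_nimber: "\<not> won p =\<^sub>I nimber n"
proof
  assume "won p =\<^sub>I nimber n"
  then have "winner p (game_sum (won p) (nimber n)) = winner p (game_sum (nimber n) (nimber n))"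
    using nimber_Im_inf[of n] by (auto simp: eq_Im_def outcome_eq_iff)
  then show False
    by (metis game_sum_won(2) is_P_def is_P_nimber_double is_form_nimber winner_won)
qed

lemma eq_Im_refl: "G =\<^sub>I G"
  by (simp add: eq_Im_def)

lemma eq_Im_sym: "G =\<^sub>I H \<Longrightarrow> H =\<^sub>I G"
  by (simp add: eq_Im_def)

lemma eq_Im_trans: "G =\<^sub>I H \<Longrightarrow> H =\<^sub>I K \<Longrightarrow> G =\<^sub>I K"
  by (simp add: eq_Im_def)

lemma nimber_in_nimbers: "nimber n \<in> nimbers"
  unfolding nimbers_def using nimber_Im_inf eq_Im_refl by blast

text \<open>The members of \<open>nimbers\<close> fall into classes indexed by numbers, and by the
  hypothesis \<open>up_to_eq A\<close> is the union of the classes with index in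
  \<open>nim_values A\<close>.\<close>

lemma up_to_eq_eq_nimbers_iff:
  assumes "\<And>H. H \<in> A \<Longrightarrow> \<exists>n. H =\<^sub>I nimber n"
  shows "up_to_eq A = nimbers \<longleftrightarrow> nim_values A = UNIV"
proof
  assume "up_to_eq A = nimbers"
  then have "nimber n \<in> up_to_eq A" for n
    using nimber_in_nimbers by simp
  then show "nim_values A = UNIV"
    unfolding up_to_eq_def nim_values_def using eq_Im_sym by blast
next
  assume "nim_values A = UNIV"
  then have "\<exists>H \<in> A. H =\<^sub>I nimber n" for n
    by (auto simp: nim_values_def)
  then show "up_to_eq A = nimbers"
    using assms by (auto simp: up_to_eq_def nimbers_def) (meson eq_Im_trans eq_Im_sym)+
qed

lemma mex_UNIV: "mex UNIV = \<infinity>"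
  unfolding mex_def by (rule Least_equality) (auto, metis enat.exhaust enat_ord_simps(3) rangeI)

lemma mex_eq_Least: "A \<noteq> UNIV \<Longrightarrow> mex A = enat (LEAST n. n \<notin> A)"
  unfolding mex_def
proof (rule Least_equality)
  assume "A \<noteq> UNIV"
  then show "enat (LEAST n. n \<notin> A) \<notin> enat ` A"
    using LeastI_ex[of "\<lambda>n. n \<notin> A"] by auto
next
  show "enat (LEAST n. n \<notin> A) \<le> x" if "x \<notin> enat ` A" for x
    using that by (cases x) (auto intro: Least_le)
qed

text \<open>Stands for \<open>\<G>(S\<^sub>G \<union> P\<^sub>G)\<close>: the option is an immediate nimber if it is quiet and a protecting
  check otherwise.\<close>

definition answered :: "player \<Rightarrow> game \<Rightarrow> nat set" where
  "answered p G = {n. \<exists>H \<in> opts p G. winner (opp p) (game_sum H (nimber n)) = p}"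

section \<open>The mex rule for symmetric games\<close>

lemma answered_symmetric:
  assumes "symmetric G"
  shows "answered q G = answered p G"
proof -
  have "answered p G \<subseteq> answered (opp p) G" for p
  proof
    fix n assume "n \<in> answered p G"
    then obtain H where H: "H \<in> opts p G" "winner (opp p) (game_sum H (nimber n)) = p"
      by (auto simp: answered_def)
    \<comment> \<open>The conjugate move wins for the other player, as nimbers are their own
      conjugates.\<close>
    have "conj_game H \<in> opts (opp p) G"
      using H(1) assms opts_conj[of "opp p" G] by (auto simp: symmetric_iff)
    moreover have "winner p (game_sum (conj_game H) (nimber n)) = opp p"
      using H(2) winner_conj[of p "game_sum H (nimber n)"] by (simp add: conj_sum conj_nimber)
    ultimately show "n \<in> answered (opp p) G"
      by (auto simp: answered_def)
  qed
  then show ?thesis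
    by (metis neq_opp_iff opp_opp subset_antisym)
qed

lemma is_P_mex_answered:
  assumes "symmetric G" "m \<notin> answered Left G" "\<And>k. k < m \<Longrightarrow> k \<in> answered Left G"
  shows "is_P (game_sum G (nimber m))"
proof -
  have G: "is_form G"
    using assms(1) by (simp add: symmetric_iff)
  have False if win: "winner p (game_sum G (nimber m)) = p" for p
  proof -
    obtain K where "K \<in> opts p (game_sum G (nimber m))" "winner (opp p) K = p"
      using win G winner_iff[of p "game_sum G (nimber m)"]
      by (metis is_form_sum is_form_nimber not_is_form_won)
    moreover have "winner (opp p) (game_sum H (nimber m)) \<noteq> p" if "H \<in> opts p G" for H
      using assms(2) that answered_symmetric[OF assms(1), of Left p] by (auto simp: answered_def)
    ultimately obtain L where L: "L \<in> opts p (nimber m)" "winner (opp p) (game_sum G L) = p"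
      using G by (auto simp: opts_sum)
    then have "m \<noteq> 0"
      using G by (cases "m = 0") (auto simp: opts_nimber)
    then obtain k where k: "k < m" "L = nimber k"
      using L by (auto simp: opts_nimber)
    \<comment> \<open>The opponent wins \<open>G + *k\<close> by a move in \<open>G\<close>, so
      moving to it was no winning move.\<close>
    then have "k \<in> answered (opp p) G"
      using assms(1,3) answered_symmetric by blast
    then obtain H where "H \<in> opts (opp p) G" "winner p (game_sum H (nimber k)) = opp p"
      by (auto simp: answered_def)
    then have "winner (opp p) (game_sum G (nimber k)) = opp p"
      using G by (subst winner_iff) (auto simp: opts_sum)
    then show False
      using L k by simp
  qed
  then show ?thesis
    by (auto simp: is_P_def)
qed

lemma answered_winner:
  assumes "symmetric G" "n \<in> answered Left G"
  shows "winner p (game_sum G (nimber n)) = p"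
proof -
  have "n \<in> answered p G"
    using assms answered_symmetric by blast
  then obtain H where "H \<in> opts p G" "winner (opp p) (game_sum H (nimber n)) = p"
    by (auto simp: answered_def)
  then show ?thesis
    using assms(1) by (subst winner_iff) (auto simp: opts_sum symmetric_iff)
qed

section \<open>Games equal to no nimber\<close>

text \<open>Checks force play to stay in \<open>K\<close>. It ends at an infinity, at a check for
  the mover, or at a quiet follower, and in each case the winner is the same with \<open>Y\<close>
  as with \<open>Z\<close>.\<close>

lemma winner_sum_replace:
  assumes "quiet Y" "quiet Z"
    and "\<And>H p. follower K H \<Longrightarrow> quiet H \<Longrightarrow> winner p (game_sum H Y) = p"
    and "\<And>H p. follower K H \<Longrightarrow> quiet H \<Longrightarrow> winner p (game_sum H Z) = p"
  shows "winner p (game_sum K Y) = winner p (game_sum K Z)"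
  using assms(3,4)
proof (induction "size K" arbitrary: K p rule: less_induct)
  case less
  have Y: "is_form Y" "is_form Z"
    using assms by (auto simp: quiet_iff)
  show ?case
  proof (cases "is_form K \<and> \<not> quiet K \<and> \<not> checks p K")
    case True
    \<comment> \<open>As \<open>K\<close> is not quiet and \<open>p\<close> has no check, the
      opponent threatens to win at once.\<close>
    then have "checks (opp p) K"
      by (metis quiet_iff neq_opp_iff)
    have "winner p (game_sum K W) = p \<longleftrightarrow> (\<exists>H \<in> opts p K. winner (opp p) (game_sum H W) = p)"
      if W: "quiet W" for W
    proof -
      \<comment> \<open>A move in \<open>W\<close> leaves the threat standing; as \<open>W\<close>
        is quiet, the only infinity it can reach is the losing one.\<close>
      have "winner (opp p) (game_sum K V) \<noteq> p" if "V \<in> opts p W" for V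
      proof (cases "is_form V")
        case True
        then show ?thesis
          using \<open>checks (opp p) K\<close> checks_sum winner_checks by (metis opp_neq(1))
      next
        case False
        then have "V = won (opp p)"
          using that W by (metis checks_def is_form_iff_won quiet_iff)
        then show ?thesis
          using True by simp
      qed
      moreover have "is_form W"
        using W by (simp add: quiet_iff)
      ultimately show ?thesis
        using True is_form_sum[of K W] by (subst winner_iff) (auto simp: opts_sum)
    qed
    moreover have "winner (opp p) (game_sum H Y) = winner (opp p) (game_sum H Z)" if "H \<in> opts p K" for H
      using less.hyps[OF size_opts[OF that]] less.prems follower_opts[OF that] by blast
    ultimately have "winner p (game_sum K Y) = p \<longleftrightarrow> winner p (game_sum K Z) = p"
      using assms(1,2) by auto
    then show ?thesis
      by (metis neq_opp_iff)
  next
    case False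
    then consider q where "K = won q" | "quiet K" | "checks p K"
      by (metis is_form_iff_won)
    then show ?thesis
    proof cases
      case 1
      then show ?thesis
        using Y by simp
    next
      case 2
      then show ?thesis
        using less.prems follower_refl by simp
    next
      case 3
      then show ?thesis
        using Y checks_sum winner_checks by metis
    qed
  qed
qed

text \<open>Induction on the total size with both games varying, so that their roles can be
  exchanged.\<close>

lemma winner_sum_not_nimber:
  assumes "affine_impartial G" "affine_impartial X" "\<And>n. \<not> is_P (game_sum G (nimber n))"
  shows "winner p (game_sum G X) = p"
  using assms
proof (induction "size G + size X" arbitrary: G X p rule: less_induct)
  case less
  note sym = less.prems(1,2)[unfolded affine_impartial_def, THEN conjunct1]
  then have form: "is_form G" "is_form X"
    by (auto simp: symmetric_iff)
  consider n where "is_P (game_sum X (nimber n))" | "checks p G" | "checks p X"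
    | "\<And>n. \<not> is_P (game_sum X (nimber n))" "\<not> checks p G" "\<not> checks p X"
    by blast
  then show ?case
  proof cases
    case 1
    \<comment> \<open>\<open>X\<close> may be replaced by \<open>nimber n\<close>, and the symmetric
      game \<open>G + *n\<close> is not a \<P>-position, so its first player wins.\<close>
    then show ?thesis
      using winner_is_P_nimber[OF 1 form(2,1)] less.prems(3)[of n]
        symmetric_is_P[OF symmetric_sum[OF sym(1) symmetric_nimber]]
      by (metis game_sum_commute)
  next
    case 2
    then show ?thesis
      using form checks_sum winner_checks by metis
  next
    case 3
    then show ?thesis
      using form checks_sum winner_checks game_sum_commute by metis
  next
    case 4
    then have "quiet X"
      using form sym symmetric_checks by (auto simp: quiet_iff)
    \<comment> \<open>The nim values of followers of \<open>G\<close>: at most one for each of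
      finitely many followers.\<close>
    define bad where "bad = (\<Union>H \<in> {H. follower G H \<and> is_form H}. {n. is_P (game_sum H (nimber n))})"
    have "finite bad"
      unfolding bad_def
    proof (rule finite_UN_I)
      show "finite {H. follower G H \<and> is_form H}"
        using finite_followers[of G] by (rule rev_finite_subset) auto
    next
      fix H assume "H \<in> {H. follower G H \<and> is_form H}"
      then have "m = n" if "is_P (game_sum H (nimber m))" "is_P (game_sum H (nimber n))" for m n
        using that winner_is_P_nimber[OF that(1), of "nimber n"]
        by (intro is_P_nimber_sumD) (simp add: is_P_def)
      then show "finite {n. is_P (game_sum H (nimber n))}"
        by (metis (mono_tags, lifting) finite.simps finite_subset insertI1 mem_Collect_eq subsetI singletonI)
    qed
    then obtain N where N: "N \<notin> bad"
      using ex_new_if_finite infinite_UNIV_nat by blast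
    \<comment> \<open>Otherwise \<open>G\<close> would equal the nimber of the least number missing
      from \<open>answered Left G\<close>.\<close>
    have "N \<in> answered p G"
    proof (rule ccontr)
      assume "N \<notin> answered p G"
      then have "\<exists>m. m \<notin> answered Left G"
        using answered_symmetric[OF sym(1)] by blast
      then show False
        using is_P_mex_answered[OF sym(1)] less.prems(3) LeastI_ex[of "\<lambda>m. m \<notin> answered Left G"]
          not_less_Least[of _ "\<lambda>m. m \<notin> answered Left G"] by blast
    qed
    then obtain K where K: "K \<in> opts p G" "winner (opp p) (game_sum K (nimber N)) = p"
      by (auto simp: answered_def)
    have "winner (opp p) (game_sum K (nimber N)) = winner (opp p) (game_sum K X)"
    proof (rule winner_sum_replace[OF quiet_nimber \<open>quiet X\<close>])
      fix H q
      assume H: "follower K H" "quiet H"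
      then have "follower G H"
        using K follower_opts by blast
      then have aff: "affine_impartial H"
        using H affine_impartial_follower less.prems by blast
      have "\<not> is_P (game_sum H (nimber N))"
        using N \<open>follower G H\<close> H by (auto simp: bad_def quiet_iff)
      then show "winner q (game_sum H (nimber N)) = q"
        using aff symmetric_is_P symmetric_sum symmetric_nimber
        unfolding affine_impartial_def by blast
      show "winner q (game_sum H X) = q"
        \<comment> \<open>The roles are exchanged: \<open>X\<close> equals no nimber, whereas
          \<open>H\<close>, which is smaller than \<open>G\<close>, may equal one.\<close>
        using less.hyps[of X H q] less.prems aff 4(1) size_opts[OF K(1)] size_follower[OF H(1)]
        by (simp add: game_sum_commute)
    qed
    moreover have "game_sum K X \<in> opts p (game_sum G X)"
      using K form by (simp add: opts_sum)
    ultimately show ?thesis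
      using K winner_iff by metis
  qed
qed

section \<open>Immediate and protected nimbers, and the theorem\<close>

lemma nim_values_eq_answered:
  assumes "G \<in> Im_inf"
  shows "nim_values (immediate_nimbers G \<union> protected_nimbers G) = answered Left G"
proof (intro set_eqI iffI)
  fix n assume "n \<in> nim_values (immediate_nimbers G \<union> protected_nimbers G)"
  then obtain K where K: "K \<in> immediate_nimbers G \<union> protected_nimbers G" "K =\<^sub>I nimber n"
    by (auto simp: nim_values_def)
  show "n \<in> answered Left G"
  proof (cases "Pos_Inf \<in> left_opts G")
    case True
    \<comment> \<open>The infinity absorbs every nimber, so this single option answers all
      numbers.\<close>
    then show ?thesis
      using winner_won[of _ Left] game_sum_won(2)[of "nimber n" Left]
      by (auto simp: answered_def intro!: bexI[of _ Pos_Inf])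
  next
    case False
    from K(1) show ?thesis
    proof
      assume imm: "K \<in> immediate_nimbers G"
      have "is_form K"
        using K(2) won_not_eq_nimber is_form_iff_won by metis
      then have "winner Right (game_sum K (nimber n)) = Left"
        using eq_nimber_iff K(2) by (metis is_P_def player.exhaust)
      then show ?thesis
        using imm by (auto simp: answered_def immediate_nimbers_def)
    next
      assume "K \<in> protected_nimbers G"
      then obtain k H where k: "K = nimber k" "H \<in> left_opts G"
        "outcome (game_sum H (nimber k)) = \<L>"
        using False by (auto simp: protected_nimbers_def)
      then have "k = n"
        using K(2) eq_nimber_iff is_P_nimber_sumD by simp
      then show ?thesis
        using k by (auto simp: answered_def outcome_L_iff)
    qed
  qed
next
  fix n assume "n \<in> answered Left G"
  then obtain H where H: "H \<in> left_opts G" "winner Right (game_sum H (nimber n)) = Left"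
    by (auto simp: answered_def)
  have "\<exists>K \<in> immediate_nimbers G \<union> protected_nimbers G. K =\<^sub>I nimber n"
  proof (cases "Pos_Inf \<in> left_opts G")
    case True
    then show ?thesis
      using nimber_in_nimbers eq_Im_refl by (auto simp: protected_nimbers_def)
  next
    case False
    have form: "is_form H"
      using False H game_sum_won(2)[OF is_form_nimber, of Right n] winner_won[of Right Right]
      by (fastforce simp: is_form_def)
    show ?thesis
    proof (cases "left_check H")
      case True
      \<comment> \<open>Outcome \<L> also requires Left to win moving first, which the check
        provides.\<close>
      then have "winner Left (game_sum H (nimber n)) = Left"
        using checks_sum[of Left H "nimber n"] winner_checks[of Left]
        by (simp add: checks_def left_check_def)
      then have "outcome (game_sum H (nimber n)) = \<L>"
        using H by (simp add: outcome_L_iff all_players)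
      then show ?thesis
        using H True False eq_Im_refl by (auto simp: protected_nimbers_def)
    next
      case False
      \<comment> \<open>Right is to move and would win at once with a check.\<close>
      moreover have "\<not> right_check H"
        using H checks_sum[of Right H "nimber n"] winner_checks[of Right]
        by (auto simp: checks_def right_check_def)
      ultimately have "quiet H"
        using form by (simp add: quiet_def is_form_def)
      moreover have "follower G H"
        using H follower_opts[of H Left G H] follower_refl by simp
      \<comment> \<open>Symmetry turns the loss of Right moving first into a \<P>-position.\<close>
      ultimately have "symmetric H"
        using assms by (simp add: Im_inf_def)
      then have "is_P (game_sum H (nimber n))"
        using symmetric_is_P[of _ Right] symmetric_sum symmetric_nimber H(2) by simp
      then have "H =\<^sub>I nimber n"
        using form eq_nimber_iff by blast
      then show ?thesis
        using H by (auto simp: immediate_nimbers_def)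
    qed
  qed
  then show "n \<in> nim_values (immediate_nimbers G \<union> protected_nimbers G)"
    by (simp add: nim_values_def)
qed

theorem theorem3p25:
  fixes G :: game
  assumes "G \<in> Im_inf"
  shows "(up_to_eq (immediate_nimbers G \<union> protected_nimbers G) = nimbers \<longrightarrow>
            G =\<^sub>I moon \<and>
            mex (nim_values (immediate_nimbers G \<union> protected_nimbers G)) = \<infinity>) \<and>
         (up_to_eq (immediate_nimbers G \<union> protected_nimbers G) \<noteq> nimbers \<longrightarrow>
            (\<exists>m. mex (nim_values (immediate_nimbers G \<union> protected_nimbers G)) = enat m \<and>
                 G =\<^sub>I nimber m))"
proof -
  let ?V = "answered Left G"
  have aff: "affine_impartial G" "symmetric G" "is_form G"
    using assms by (auto simp: Im_inf_iff affine_impartial_def symmetric_iff)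
  have full: "up_to_eq (immediate_nimbers G \<union> protected_nimbers G) = nimbers \<longleftrightarrow> ?V = UNIV"
    unfolding nim_values_eq_answered[OF assms, symmetric]
    by (rule up_to_eq_eq_nimbers_iff)
      (auto simp: immediate_nimbers_def protected_nimbers_def nimbers_def
        intro: eq_Im_refl split: if_splits)
  have "G =\<^sub>I moon" if "?V = UNIV"
  proof -
    \<comment> \<open>The first player wins every sum of \<open>G\<close> with a nimber, so
      \<open>G\<close> equals no nimber.\<close>
    have "\<not> is_P (game_sum G (nimber n))" for n
      using answered_winner[OF aff(2)] that by (auto simp: is_P_def)
    then have "winner p (game_sum G X) = p" if "X \<in> Im_inf" for X p
      using winner_sum_not_nimber[OF aff(1)] that by (simp add: Im_inf_iff)
    \<comment> \<open>The moon gives both players a check, which survives the addition of a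
      form.\<close>
    moreover have "winner p (game_sum moon X) = p" if "X \<in> Im_inf" for X p
      using that by (intro winner_checks checks_sum)
        (cases p; auto simp: checks_def moon_def Im_inf_def symmetric_iff)+
    ultimately show ?thesis
      by (simp add: eq_Im_def outcome_eq_iff)
  qed
  moreover have "G =\<^sub>I nimber (LEAST n. n \<notin> ?V)" if "?V \<noteq> UNIV"
    using is_P_mex_answered[OF aff(2)] LeastI_ex[of "\<lambda>n. n \<notin> ?V"] not_less_Least that
      eq_nimber_iff[OF aff(3)] by blast
  ultimately show ?thesis
    unfolding full nim_values_eq_answered[OF assms] using mex_UNIV mex_eq_Least by auto
qed

end
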